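(* If there exists a consistent pricing system (CPS), then the no-arbitrage condition (NA) is satisfied.
   Context: Fix integers $T\ge 1$, $N\ge 1$ and a filtered probability space $(\Omega,\mathcal{F}_T,\mathbb{F}=(\mathcal{F}_t)_{t=0}^T,\mathbb{P})$. All equalities and inequalities between random variables/processes are $\mathbb{P}$-a.s. and coordinate-wise. $\Delta X_t:=X_t-X_{t-1}$. Market: a savings account $B_t=\prod_{s=0}^t(1+r_s)$, with $r=(r_t)_{t=0}^T$ a nonnegative adapted process, $r_0=0$ (so $B_0=1$); adapted $\mathbb{R}^N$-valued ex-dividend price processes $P^{ask},P^{bid}$ (indexed by $t=0,\dots,T$) and adapted $\mathbb{R}^N$-valued cumulative dividend processes $A^{ask},A^{bid}$ (indexed by $t=1,\dots,T$, with the convention $A^{ask}_0=A^{bid}_0=0$). Standing Bid-Ask Assumption: $P^{ask}\ge P^{bid}$ and $\Delta A^{ask}\le\Delta A^{bid}$. Discounted processes: $P^{ask,*}=B^{-1}P^{ask}$, $P^{bid,*}=B^{-1}P^{bid}$, $A^{ask,*}=B^{-1}\Delta A^{ask}$, $A^{bid,*}=B^{-1}\Delta A^{bid}$. A trading strategy is an $\mathbb{R}^{N+1}$-valued predictable process $\phi=(\phi^0_t,\phi^1_t,\dots,\phi^N_t)_{t=1}^T$ ($\phi_t$ is $\mathcal{F}_{t-1}$-measurable), with convention $\phi_0=0$. Its value process is $V_0(\phi)=\phi^0_1+\sum_{j=1}^N\phi^j_1(1_{\{\phi^j_1\ge0\}}P^{ask,j}_0+1_{\{\phi^j_1<0\}}P^{bid,j}_0)$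 and, for $1\le t\le T$, $V_t(\phi)=\phi^0_tB_t+\sum_{j=1}^N\phi^j_t(1_{\{\phi^j_t\ge0\}}P^{bid,j}_t+1_{\{\phi^j_t<0\}}P^{ask,j}_t)+\sum_{j=1}^N\phi^j_t(1_{\{\phi^j_t\ge0\}}\Delta A^{ask,j}_t+1_{\{\phi^j_t<0\}}\Delta A^{bid,j}_t)$. $\phi$ is self-financing if for $t=1,\dots,T-1$: $B_t\Delta\phi^0_{t+1}+\sum_{j=1}^N\Delta\phi^j_{t+1}(1_{\{\Delta\phi^j_{t+1}\ge0\}}P^{ask,j}_t+1_{\{\Delta\phi^j_{t+1}<0\}}P^{bid,j}_t)=\sum_{j=1}^N\phi^j_t(1_{\{\phi^j_t\ge0\}}\Delta A^{ask,j}_t+1_{\{\phi^j_t<0\}}\Delta A^{bid,j}_t)$. $\mathcal{S}$ is the set of self-financing trading strategies. (NA): for each $\phi\in\mathcal{S}$ with $V_0(\phi)=0$ and $V_T(\phi)\ge0$, one has $V_T(\phi)=0$. $\mathcal{Z}$ is the set of probability measures $\mathbb{Q}$ on $\mathcal{F}_T$ with $\mathbb{Q}\sim\mathbb{P}$ such that $P^{ask,*},P^{bid,*},A^{ask,*},A^{bid,*}$ are $\mathbb{Q}$-integrable. A consistent pricing system is a quadruplet $\{\mathbb{Q},P,A,M\}$ consisting of a probability measure $\mathbb{Q}\in\mathcal{Z}$; an adapted process $P$ with $P^{bid,*}\le P\le P^{ask,*}$; an adapted process $A$ with $A^{ask,*}\le A\le A^{bid,*}$; and a $\mathbb{Q}$-martingale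 $M$ with $M_t=P_t+\sum_{u=1}^tA_u$ for all $t\in\{0,\dots,T\}$. *)

theory Defs
  imports "HOL-Probability.Probability"
begin

definition adapted_on :: "nat set \<Rightarrow> (nat \<Rightarrow> 'a measure) \<Rightarrow> (nat \<Rightarrow> 'a \<Rightarrow> 'b::topological_space) \<Rightarrow> bool"
  where "adapted_on I F X \<longleftrightarrow> (\<forall>t\<in>I. X t \<in> borel_measurable (F t))"

(* Conditional expectations of vector-valued variables are taken coordinate by coordinate, since
   real_cond_exp is defined for real-valued functions only. *)
definition martingale_upto ::
  "nat \<Rightarrow> 'a measure \<Rightarrow> (nat \<Rightarrow> 'a measure) \<Rightarrow> (nat \<Rightarrow> 'a \<Rightarrow> real ^ 'n::finite) \<Rightarrow> bool"
  where "martingale_upto T Q F X \<longleftrightarrow>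
    adapted_on {0..T} F X \<and>
    (\<forall>t\<in>{0..T}. integrable Q (X t)) \<and>
    (\<forall>s t. s \<le> t \<longrightarrow> t \<le> T \<longrightarrow>
      (AE \<omega> in Q. \<forall>j. real_cond_exp Q (F s) (\<lambda>\<omega>'. X t \<omega>' $ j) \<omega> = X s \<omega> $ j))"

(* M is the probability space carrying the reference measure, on the sigma-algebra F T.  Assets are
   indexed by the finite type 'n, and the order on real ^ 'n is the coordinate-wise one.  Processes
   are total functions of time, of which only the values at times in {0..T} (or {1..T}) matter. *)
locale bid_ask_market = prob_space M
  for M :: "'a measure" +
  fixes T :: nat
    and F :: "nat \<Rightarrow> 'a measure"
    and r :: "nat \<Rightarrow> 'a \<Rightarrow> real"
    and P_ask P_bid A_ask A_bid :: "nat \<Rightarrow> 'a \<Rightarrow> real ^ 'n::finite"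
  assumes T_ge_1: "1 \<le> T"
    and filtration_mono: "\<And>s t. s \<le> t \<Longrightarrow> t \<le> T \<Longrightarrow> subalgebra (F t) (F s)"
    and sets_F_T: "sets (F T) = sets M"
    and r_adapted: "adapted_on {0..T} F r"
    and r_nonneg: "\<And>t. t \<le> T \<Longrightarrow> AE \<omega> in M. 0 \<le> r t \<omega>"
    and r_0: "AE \<omega> in M. r 0 \<omega> = 0"
    and P_ask_adapted: "adapted_on {0..T} F P_ask"
    and P_bid_adapted: "adapted_on {0..T} F P_bid"
    and A_ask_adapted: "adapted_on {1..T} F A_ask"
    and A_bid_adapted: "adapted_on {1..T} F A_bid"
    and A_ask_0: "A_ask 0 = (\<lambda>_. 0)"
    and A_bid_0: "A_bid 0 = (\<lambda>_. 0)"
    and bid_le_ask: "\<And>t. t \<le> T \<Longrightarrow> AE \<omega> in M. P_bid t \<omega> \<le> P_ask t \<omega>"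
    and dividends_ask_le_bid: "\<And>t. 1 \<le> t \<Longrightarrow> t \<le> T \<Longrightarrow>
      AE \<omega> in M. A_ask t \<omega> - A_ask (t - 1) \<omega> \<le> A_bid t \<omega> - A_bid (t - 1) \<omega>"
begin

definition B :: "nat \<Rightarrow> 'a \<Rightarrow> real"
  where "B t \<omega> = (\<Prod>s=0..t. 1 + r s \<omega>)"

(* Increments are meant for t >= 1 only. *)
definition dA_ask :: "nat \<Rightarrow> 'a \<Rightarrow> real ^ 'n"
  where "dA_ask t \<omega> = A_ask t \<omega> - A_ask (t - 1) \<omega>"

definition dA_bid :: "nat \<Rightarrow> 'a \<Rightarrow> real ^ 'n"
  where "dA_bid t \<omega> = A_bid t \<omega> - A_bid (t - 1) \<omega>"

definition P_ask_disc :: "nat \<Rightarrow> 'a \<Rightarrow> real ^ 'n"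
  where "P_ask_disc t \<omega> = inverse (B t \<omega>) *\<^sub>R P_ask t \<omega>"

definition P_bid_disc :: "nat \<Rightarrow> 'a \<Rightarrow> real ^ 'n"
  where "P_bid_disc t \<omega> = inverse (B t \<omega>) *\<^sub>R P_bid t \<omega>"

(* The discounted dividend processes discount the increments, not the cumulative processes. *)
definition A_ask_disc :: "nat \<Rightarrow> 'a \<Rightarrow> real ^ 'n"
  where "A_ask_disc t \<omega> = inverse (B t \<omega>) *\<^sub>R dA_ask t \<omega>"

definition A_bid_disc :: "nat \<Rightarrow> 'a \<Rightarrow> real ^ 'n"
  where "A_bid_disc t \<omega> = inverse (B t \<omega>) *\<^sub>R dA_bid t \<omega>"

(* A strategy takes values in R^(N+1), represented as R x R^N: the first component is the holding
   in the savings account. *)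
definition trading_strategy :: "(nat \<Rightarrow> 'a \<Rightarrow> real \<times> (real ^ 'n)) \<Rightarrow> bool"
  where "trading_strategy \<phi> \<longleftrightarrow>
    \<phi> 0 = (\<lambda>_. 0) \<and> (\<forall>t\<in>{1..T}. \<phi> t \<in> borel_measurable (F (t - 1)))"

definition V :: "(nat \<Rightarrow> 'a \<Rightarrow> real \<times> (real ^ 'n)) \<Rightarrow> nat \<Rightarrow> 'a \<Rightarrow> real"
  where "V \<phi> t \<omega> =
    (if t = 0 then
       fst (\<phi> 1 \<omega>) +
       (\<Sum>j\<in>UNIV. let x = snd (\<phi> 1 \<omega>) $ j in
          x * (if x \<ge> 0 then P_ask 0 \<omega> $ j else P_bid 0 \<omega> $ j))
     else
       fst (\<phi> t \<omega>) * B t \<omega> +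
       (\<Sum>j\<in>UNIV. let x = snd (\<phi> t \<omega>) $ j in
          x * (if x \<ge> 0 then P_bid t \<omega> $ j else P_ask t \<omega> $ j)) +
       (\<Sum>j\<in>UNIV. let x = snd (\<phi> t \<omega>) $ j in
          x * (if x \<ge> 0 then dA_ask t \<omega> $ j else dA_bid t \<omega> $ j)))"

definition self_financing :: "(nat \<Rightarrow> 'a \<Rightarrow> real \<times> (real ^ 'n)) \<Rightarrow> bool"
  where "self_financing \<phi> \<longleftrightarrow>
    (\<forall>t\<in>{1..T - 1}. AE \<omega> in M.
       B t \<omega> * (fst (\<phi> (t + 1) \<omega>) - fst (\<phi> t \<omega>)) +
       (\<Sum>j\<in>UNIV. let d = snd (\<phi> (t + 1) \<omega>) $ j - snd (\<phi> t \<omega>) $ j in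
          d * (if d \<ge> 0 then P_ask t \<omega> $ j else P_bid t \<omega> $ j))
       = (\<Sum>j\<in>UNIV. let x = snd (\<phi> t \<omega>) $ j in
          x * (if x \<ge> 0 then dA_ask t \<omega> $ j else dA_bid t \<omega> $ j)))"

definition self_financing_strategies :: "(nat \<Rightarrow> 'a \<Rightarrow> real \<times> (real ^ 'n)) set"
  where "self_financing_strategies = {\<phi>. trading_strategy \<phi> \<and> self_financing \<phi>}"

definition NA :: bool
  where "NA \<longleftrightarrow>
    (\<forall>\<phi>\<in>self_financing_strategies.
       (AE \<omega> in M. V \<phi> 0 \<omega> = 0) \<longrightarrow> (AE \<omega> in M. V \<phi> T \<omega> \<ge> 0) \<longrightarrow> (AE \<omega> in M. V \<phi> T \<omega> = 0))"

definition Z :: "'a measure set"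
  where "Z = {Q. prob_space Q \<and> sets Q = sets M \<and>
    absolutely_continuous M Q \<and> absolutely_continuous Q M \<and>
    (\<forall>t\<in>{0..T}. integrable Q (P_ask_disc t) \<and> integrable Q (P_bid_disc t)) \<and>
    (\<forall>t\<in>{1..T}. integrable Q (A_ask_disc t) \<and> integrable Q (A_bid_disc t))}"

definition consistent_pricing_system ::
  "'a measure \<Rightarrow> (nat \<Rightarrow> 'a \<Rightarrow> real ^ 'n) \<Rightarrow> (nat \<Rightarrow> 'a \<Rightarrow> real ^ 'n) \<Rightarrow> (nat \<Rightarrow> 'a \<Rightarrow> real ^ 'n) \<Rightarrow> bool"
  where "consistent_pricing_system Q P A X \<longleftrightarrow>
    Q \<in> Z \<and>
    adapted_on {0..T} F P \<and>
    (\<forall>t\<in>{0..T}. AE \<omega> in M. P_bid_disc t \<omega> \<le> P t \<omega> \<and> P t \<omega> \<le> P_ask_disc t \<omega>) \<and>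
    adapted_on {1..T} F A \<and>
    (\<forall>t\<in>{1..T}. AE \<omega> in M. A_ask_disc t \<omega> \<le> A t \<omega> \<and> A t \<omega> \<le> A_bid_disc t \<omega>) \<and>
    martingale_upto T Q F X \<and>
    (\<forall>t\<in>{0..T}. AE \<omega> in M. X t \<omega> = P t \<omega> + (\<Sum>u=1..t. A u \<omega>))"

end

end

theory Submission
  imports Defs
begin

text \<open>
  Trading the stock at the frictionless price \<open>P\<close> with dividends \<open>A\<close> is never worse than trading at
  the bid and ask quotes, so the discounted terminal value of a self-financing strategy with zero
  initial value is at most the transform \<open>\<Sum>t. \<phi> t \<bullet> (X t - X (t - 1))\<close> of the martingale
  \<open>X = P + \<Sum>A\<close>. It thus suffices that a nonnegative terminal value of a martingale transform
  vanishes, even though the integrand \<open>H\<close> need not be bounded. By induction on the horizon \<open>k\<close>: on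
  the event that the transform is negative at time \<open>k - 1\<close>, its last increment is positive, but
  on \<open>norm (H k) \<le> n\<close> this increment has mean zero; so the event is null, the transform vanishes at
  time \<open>k - 1\<close> by induction, and the last increment is then nonnegative with mean zero on each of the
  events \<open>norm (H k) \<le> n\<close>.
\<close>

section \<open>Martingale increments and martingale transforms\<close>

lemma borel_measurable_vec_component:
  fixes f :: "'a \<Rightarrow> real ^ 'n::finite"
  assumes "f \<in> borel_measurable M"
  shows "(\<lambda>\<omega>. f \<omega> $ j) \<in> borel_measurable M"
  using borel_measurable_continuous_on[OF _ assms, of "\<lambda>x. x $ j"]
  by (simp add: continuous_on_component)

lemma integrable_vec_component:
  fixes f :: "'a \<Rightarrow> real ^ 'n::finite"
  assumes "integrable M f"
  shows "integrable M (\<lambda>\<omega>. f \<omega> $ j)"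
  using integrable_inner_left[of "axis j 1" M f] assms by (simp add: inner_axis)

text \<open>Boundedness of \<open>x\<close> on \<open>A\<close> turns
  \<open>indicator A \<omega> * x \<omega> $ j\<close> into a bounded \<open>F\<close>-measurable
  factor, which can be moved through the conditional expectation of each coordinate of
  \<open>D\<close>.\<close>

lemma (in sigma_finite_subalgebra) integral_inner_cond_exp_zero:
  fixes x D :: "'a \<Rightarrow> real ^ 'n::finite"
  assumes D: "integrable M D"
    and D0: "\<And>j. AE \<omega> in M. real_cond_exp M F (\<lambda>\<omega>. D \<omega> $ j) \<omega> = 0"
    and x: "x \<in> borel_measurable F"
    and A: "A \<in> sets F"
    and bound: "\<And>\<omega>. \<omega> \<in> A \<Longrightarrow> norm (x \<omega>) \<le> c"
  shows "integrable M (\<lambda>\<omega>. indicator A \<omega> * (x \<omega> \<bullet> D \<omega>))"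
    and "(\<integral>\<omega>. indicator A \<omega> * (x \<omega> \<bullet> D \<omega>) \<partial>M) = 0"
proof -
  define f where "f j \<omega> = indicator A \<omega> * x \<omega> $ j" for j \<omega>
  have f: "f j \<in> borel_measurable F" for j
    unfolding f_def using borel_measurable_vec_component[OF x] A by measurable
  \<comment> \<open>The bound must hold off \<open>A\<close> too, where \<open>f\<close> vanishes;
    \<open>c\<close> may be negative if \<open>A\<close> is empty, hence
    \<open>\<bar>c\<bar>\<close>.\<close>
  have f_le: "\<bar>f j \<omega>\<bar> \<le> \<bar>c\<bar>" for j \<omega>
    unfolding f_def using component_le_norm_cart[of "x \<omega>" j] bound[of \<omega>]
    by (auto simp: indicator_def)
  have int: "integrable M (\<lambda>\<omega>. f j \<omega> * D \<omega> $ j)" for j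
  proof (rule Bochner_Integration.integrable_bound)
    show "integrable M (\<lambda>\<omega>. \<bar>c\<bar> * D \<omega> $ j)"
      using integrable_vec_component[OF D] by simp
    show "(\<lambda>\<omega>. f j \<omega> * D \<omega> $ j) \<in> borel_measurable M"
      using measurable_from_subalg[OF subalg f]
        borel_measurable_integrable[OF integrable_vec_component[OF D]] by measurable
    show "AE \<omega> in M. norm (f j \<omega> * D \<omega> $ j) \<le> norm (\<bar>c\<bar> * D \<omega> $ j)"
      using f_le by (auto simp: abs_mult intro!: mult_right_mono)
  qed
  have zero: "(\<integral>\<omega>. f j \<omega> * D \<omega> $ j \<partial>M) = 0" for j
  proof -
    have "(\<integral>\<omega>. f j \<omega> * D \<omega> $ j \<partial>M) = (\<integral>\<omega>. f j \<omega> * real_cond_exp M F (\<lambda>\<omega>. D \<omega> $ j) \<omega> \<partial>M)"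
      using real_cond_exp_intg(2)[OF int f]
        borel_measurable_integrable[OF integrable_vec_component[OF D]] by simp
    also have "\<dots> = (\<integral>\<omega>. 0 \<partial>M)"
      using D0[of j] measurable_from_subalg[OF subalg f] by (intro integral_cong_AE) auto
    finally show ?thesis by simp
  qed
  have eq: "indicator A \<omega> * (x \<omega> \<bullet> D \<omega>) = (\<Sum>j\<in>UNIV. f j \<omega> * D \<omega> $ j)" for \<omega>
    by (simp add: f_def inner_vec_def sum_distrib_left mult.assoc)
  show "integrable M (\<lambda>\<omega>. indicator A \<omega> * (x \<omega> \<bullet> D \<omega>))"
    unfolding eq using int by simp
  show "(\<integral>\<omega>. indicator A \<omega> * (x \<omega> \<bullet> D \<omega>) \<partial>M) = 0"
    unfolding eq using int zero by simp
qed

text \<open>For unbounded \<open>x\<close> the product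
  \<open>x \<omega> \<bullet> D \<omega>\<close> may fail to be integrable. Cutting \<open>A\<close>
  down to the \<open>F\<close>-events \<open>norm (x \<omega>) \<le> real n\<close> leaves
  nonnegative functions with integral zero, which vanish almost everywhere.\<close>

lemma (in sigma_finite_subalgebra) AE_inner_cond_exp_zero:
  fixes x D :: "'a \<Rightarrow> real ^ 'n::finite"
  assumes D: "integrable M D"
    and D0: "\<And>j. AE \<omega> in M. real_cond_exp M F (\<lambda>\<omega>. D \<omega> $ j) \<omega> = 0"
    and x: "x \<in> borel_measurable F"
    and A: "A \<in> sets F"
    and nonneg: "AE \<omega> in M. \<omega> \<in> A \<longrightarrow> 0 \<le> x \<omega> \<bullet> D \<omega>"
  shows "AE \<omega> in M. \<omega> \<in> A \<longrightarrow> x \<omega> \<bullet> D \<omega> = 0"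
proof -
  define An where "An n = A \<inter> {\<omega> \<in> space F. norm (x \<omega>) \<le> real n}" for n
  have An: "An n \<in> sets F" for n
    unfolding An_def using x A by measurable
  have "AE \<omega> in M. indicator (An n) \<omega> * (x \<omega> \<bullet> D \<omega>) = 0" for n
  proof -
    note I = integral_inner_cond_exp_zero[OF D D0 x An[of n], of "real n"]
    have "AE \<omega> in M. 0 \<le> indicator (An n) \<omega> * (x \<omega> \<bullet> D \<omega>)"
      using nonneg by eventually_elim (auto simp: An_def indicator_def)
    then show ?thesis
      using integral_nonneg_eq_0_iff_AE[OF I(1)] I(2) by (auto simp: An_def)
  qed
  \<comment> \<open>One null set must serve every \<open>n\<close>, as the level chosen below
    depends on \<open>\<omega>\<close>.\<close>
  then have "AE \<omega> in M. \<forall>n. indicator (An n) \<omega> * (x \<omega> \<bullet> D \<omega>) = 0"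
    by (subst AE_all_countable) blast
  then show ?thesis
  proof eventually_elim
    case (elim \<omega>)
    obtain n :: nat where "norm (x \<omega>) \<le> real n"
      using real_arch_simple by blast
    moreover have "\<omega> \<in> space F" if "\<omega> \<in> A"
      using that sets.sets_into_space[OF A] by auto
    ultimately show ?case
      using elim[rule_format, of n] by (auto simp: An_def)
  qed
qed

lemma martingale_transform_nonneg_imp_zero:
  fixes X H :: "nat \<Rightarrow> 'a \<Rightarrow> real ^ 'n::finite"
  assumes Q: "finite_measure Q"
    and sub: "\<And>t. t \<le> T \<Longrightarrow> subalgebra Q (F t)"
    and mono: "\<And>s t. s \<le> t \<Longrightarrow> t \<le> T \<Longrightarrow> subalgebra (F t) (F s)"
    and X: "martingale_upto T Q F X"
    and H: "\<And>t. t \<in> {1..T} \<Longrightarrow> H t \<in> borel_measurable (F (t - 1))"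
    and "k \<le> T"
    and "AE \<omega> in Q. 0 \<le> (\<Sum>t=1..k. H t \<omega> \<bullet> (X t \<omega> - X (t - 1) \<omega>))"
  shows "AE \<omega> in Q. (\<Sum>t=1..k. H t \<omega> \<bullet> (X t \<omega> - X (t - 1) \<omega>)) = 0"
  using assms(6,7)
proof (induction k)
  case 0
  then show ?case by simp
next
  case (Suc k)
  then have k: "k \<le> T" "Suc k \<le> T" by auto
  interpret Q: finite_measure Q by fact
  interpret fin: finite_measure_subalgebra Q "F k"
    by unfold_locales (rule sub[OF k(1)])
  have space: "space (F k) = space Q"
    using sub[OF k(1)] by (simp add: subalgebra_def)
  define D where "D \<omega> = X (Suc k) \<omega> - X k \<omega>" for \<omega>
  define Y where "Y \<omega> = (\<Sum>t=1..k. H t \<omega> \<bullet> (X t \<omega> - X (t - 1) \<omega>))" for \<omega>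
  have X_int: "integrable Q (X t)" if "t \<le> T" for t
    using X that by (auto simp: martingale_upto_def)
  have X_meas: "X t \<in> borel_measurable (F k)" if "t \<le> k" for t
  proof (rule measurable_from_subalg[OF mono[OF that k(1)]])
    show "X t \<in> borel_measurable (F t)"
      using X that k by (simp add: martingale_upto_def adapted_on_def)
  qed
  have D: "integrable Q D"
    unfolding D_def using X_int k by simp
  have D0: "AE \<omega> in Q. real_cond_exp Q (F k) (\<lambda>\<omega>. D \<omega> $ j) \<omega> = 0" for j
  proof -
    have "AE \<omega> in Q. \<forall>j. real_cond_exp Q (F k) (\<lambda>\<omega>'. X (Suc k) \<omega>' $ j) \<omega> = X k \<omega> $ j"
      using X k by (auto simp: martingale_upto_def)
    moreover have "AE \<omega> in Q. real_cond_exp Q (F k) (\<lambda>\<omega>'. X k \<omega>' $ j) \<omega> = X k \<omega> $ j"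
      using fin.real_cond_exp_F_meas integrable_vec_component[OF X_int[OF k(1)]]
        borel_measurable_vec_component[OF X_meas[OF order_refl]] by blast
    moreover have "AE \<omega> in Q. real_cond_exp Q (F k) (\<lambda>\<omega>. X (Suc k) \<omega> $ j - X k \<omega> $ j) \<omega> =
        real_cond_exp Q (F k) (\<lambda>\<omega>. X (Suc k) \<omega> $ j) \<omega> - real_cond_exp Q (F k) (\<lambda>\<omega>. X k \<omega> $ j) \<omega>"
      using fin.real_cond_exp_diff integrable_vec_component X_int k by blast
    ultimately show ?thesis
      unfolding D_def by eventually_elim simp
  qed
  have Hk: "H (Suc k) \<in> borel_measurable (F k)"
    using H[of "Suc k"] k by simp
  \<comment> \<open>Past gains are known at time \<open>k\<close>, so their sign defines an event on
    which the next increment can be localised.\<close>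
  have Y: "Y \<in> borel_measurable (F k)"
    unfolding Y_def
  proof (intro borel_measurable_sum borel_measurable_inner borel_measurable_diff X_meas)
    fix t assume t: "t \<in> {1..k}"
    then show "H t \<in> borel_measurable (F k)"
      using measurable_from_subalg[OF mono[of "t - 1" k] H[of t]] k by auto
  qed auto
  have split: "(\<Sum>t=1..Suc k. H t \<omega> \<bullet> (X t \<omega> - X (t - 1) \<omega>)) = Y \<omega> + H (Suc k) \<omega> \<bullet> D \<omega>" for \<omega>
    by (simp add: Y_def D_def)
  have sum_nonneg: "AE \<omega> in Q. 0 \<le> Y \<omega> + H (Suc k) \<omega> \<bullet> D \<omega>"
    using Suc.prems(2) by (simp only: split)
  have "AE \<omega> in Q. \<omega> \<in> {\<omega> \<in> space (F k). Y \<omega> < 0} \<longrightarrow> H (Suc k) \<omega> \<bullet> D \<omega> = 0"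
  proof (rule fin.AE_inner_cond_exp_zero[OF D D0 Hk])
    show "{\<omega> \<in> space (F k). Y \<omega> < 0} \<in> sets (F k)"
      using Y by measurable
    show "AE \<omega> in Q. \<omega> \<in> {\<omega> \<in> space (F k). Y \<omega> < 0} \<longrightarrow> 0 \<le> H (Suc k) \<omega> \<bullet> D \<omega>"
      using sum_nonneg by eventually_elim auto
  qed
  \<comment> \<open>Where \<open>Y \<omega> < 0\<close>, the total would equal
    \<open>Y \<omega>\<close>, against \<open>sum_nonneg\<close>.\<close>
  then have "AE \<omega> in Q. 0 \<le> Y \<omega>"
    using sum_nonneg AE_space[of Q] by eventually_elim (force simp: space)
  then have Y0: "AE \<omega> in Q. Y \<omega> = 0"
    unfolding Y_def using Suc.IH k by blast
  \<comment> \<open>With zero past gains the last increment is the whole sum, hence nonnegative, and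
    the event can be the full space.\<close>
  have "AE \<omega> in Q. \<omega> \<in> space (F k) \<longrightarrow> H (Suc k) \<omega> \<bullet> D \<omega> = 0"
  proof (rule fin.AE_inner_cond_exp_zero[OF D D0 Hk])
    show "AE \<omega> in Q. \<omega> \<in> space (F k) \<longrightarrow> 0 \<le> H (Suc k) \<omega> \<bullet> D \<omega>"
      using sum_nonneg Y0 by eventually_elim auto
  qed simp
  then show ?case
    unfolding split using Y0 AE_space[of Q] by eventually_elim (simp add: space)
qed

section \<open>Bid-ask spread against a frictionless price in between\<close>

lemma inner_le_sum_bid_ask:
  fixes x p lo hi :: "real ^ 'n::finite"
  assumes "lo \<le> p" "p \<le> hi"
  shows "x \<bullet> p \<le> (\<Sum>j\<in>UNIV. let y = x $ j in y * (if y \<ge> 0 then hi $ j else lo $ j))"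
  unfolding inner_vec_def
proof (rule sum_mono)
  fix j
  have "lo $ j \<le> p $ j" "p $ j \<le> hi $ j"
    using assms by (auto simp: less_eq_vec_def)
  then show "x $ j \<bullet> p $ j \<le> (let y = x $ j in y * (if y \<ge> 0 then hi $ j else lo $ j))"
    by (auto simp: Let_def intro: mult_left_mono mult_left_mono_neg)
qed

text \<open>Counterpart for receipts: the sign of each coordinate selects the unfavourable end of
  the interval. This serves both liquidation and dividends, the ask dividends being the lower
  end.\<close>

lemma sum_bid_ask_le_inner:
  fixes x p lo hi :: "real ^ 'n::finite"
  assumes "lo \<le> p" "p \<le> hi"
  shows "(\<Sum>j\<in>UNIV. let y = x $ j in y * (if y \<ge> 0 then lo $ j else hi $ j)) \<le> x \<bullet> p"
  unfolding inner_vec_def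
proof (rule sum_mono)
  fix j
  have "lo $ j \<le> p $ j" "p $ j \<le> hi $ j"
    using assms by (auto simp: less_eq_vec_def)
  then show "(let y = x $ j in y * (if y \<ge> 0 then lo $ j else hi $ j)) \<le> x $ j \<bullet> p $ j"
    by (auto simp: Let_def intro: mult_left_mono mult_left_mono_neg)
qed

text \<open>Pathwise telescoping in discounted units: \<open>a\<close> is the savings holding, and
  the left side is wealth before rebalancing, dividends included. The inequalities in
  \<open>init\<close> and \<open>step\<close> leave room for losses to the spread.\<close>

lemma frictionless_wealth_le_gains:
  fixes x p d m :: "nat \<Rightarrow> 'v::real_inner" and a :: "nat \<Rightarrow> real"
  assumes init: "a 1 + x 1 \<bullet> p 0 \<le> 0"
    and step: "\<And>t. t \<in> {1..T - 1} \<Longrightarrow> a (t + 1) - a t + (x (t + 1) - x t) \<bullet> p t \<le> x t \<bullet> d t"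
    and m: "\<And>t. t \<le> T \<Longrightarrow> m t = p t + (\<Sum>u=1..t. d u)"
    and "1 \<le> k" "k \<le> T"
  shows "a k + x k \<bullet> p k + x k \<bullet> d k \<le> (\<Sum>t=1..k. x t \<bullet> (m t - m (t - 1)))"
  using \<open>1 \<le> k\<close> \<open>k \<le> T\<close>
proof (induction k rule: dec_induct)
  case base
  have "m 1 - m 0 = p 1 + d 1 - p 0"
    using m[of 1] m[of 0] base by simp
  then show ?case
    using init by (simp add: inner_simps)
next
  case (step k)
  have "m (Suc k) - m k = p (Suc k) + d (Suc k) - p k"
    using m[of "Suc k"] m[of k] step by simp
  then have "x (Suc k) \<bullet> (m (Suc k) - m k) =
      x (Suc k) \<bullet> p (Suc k) + x (Suc k) \<bullet> d (Suc k) - x (Suc k) \<bullet> p k"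
    by (simp add: inner_simps)
  \<comment> \<open>The budget at date \<open>k\<close>, which lies in \<open>{1..T - 1}\<close>
    because \<open>Suc k \<le> T\<close>.\<close>
  moreover have "a (Suc k) - a k + (x (Suc k) - x k) \<bullet> p k \<le> x k \<bullet> d k"
    using assms(2)[of k] step by simp
  ultimately show ?case
    using step by (simp add: inner_simps)
qed

lemma inverse_scaleR_le_iff:
  fixes p q :: "real ^ 'n::finite"
  assumes "0 < b"
  shows "inverse b *\<^sub>R p \<le> q \<longleftrightarrow> p \<le> b *\<^sub>R q" and "q \<le> inverse b *\<^sub>R p \<longleftrightarrow> b *\<^sub>R q \<le> p"
  using assms by (auto simp: less_eq_vec_def field_simps)

section \<open>Comparison of values in the market, and absence of arbitrage\<close>

context bid_ask_market
begin

lemma AE_B_pos: "AE \<omega> in M. \<forall>t\<in>{0..T}. 0 < B t \<omega>"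
proof -
  have "AE \<omega> in M. \<forall>t\<in>{0..T}. 0 \<le> r t \<omega>"
    using r_nonneg by (intro AE_finite_allI) auto
  then show ?thesis
    by eventually_elim (auto simp: B_def intro!: prod_pos add_pos_nonneg)
qed

text \<open>Finitely many dates are involved, so all almost sure hypotheses hold on one event, and
  the frictionless comparison is made path by path there.\<close>

lemma AE_discounted_value_le_gains:
  assumes cps: "consistent_pricing_system Q P A X"
    and sf: "self_financing \<phi>"
    and V0: "AE \<omega> in M. V \<phi> 0 \<omega> = 0"
  shows "AE \<omega> in M. V \<phi> T \<omega> / B T \<omega> \<le> (\<Sum>t=1..T. snd (\<phi> t \<omega>) \<bullet> (X t \<omega> - X (t - 1) \<omega>))"
proof -
  let ?cost = "\<lambda>x lo hi. \<Sum>j\<in>UNIV. let y = x $ j in y * (if y \<ge> 0 then hi $ j else lo $ j)"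
  have P: "AE \<omega> in M. \<forall>t\<in>{0..T}. P_bid_disc t \<omega> \<le> P t \<omega> \<and> P t \<omega> \<le> P_ask_disc t \<omega>"
    using cps unfolding consistent_pricing_system_def by (intro AE_finite_allI) auto
  have A: "AE \<omega> in M. \<forall>t\<in>{1..T}. A_ask_disc t \<omega> \<le> A t \<omega> \<and> A t \<omega> \<le> A_bid_disc t \<omega>"
    using cps unfolding consistent_pricing_system_def by (intro AE_finite_allI) auto
  have X: "AE \<omega> in M. \<forall>t\<in>{0..T}. X t \<omega> = P t \<omega> + (\<Sum>u=1..t. A u \<omega>)"
    using cps unfolding consistent_pricing_system_def by (intro AE_finite_allI) auto
  \<comment> \<open>On the right the \<open>hi\<close> slot of \<open>?cost\<close> holds the
    smaller \<open>dA_ask\<close>, so the sum is a receipt, at most the frictionless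
    dividend.\<close>
  have SF: "AE \<omega> in M. \<forall>t\<in>{1..T - 1}.
      B t \<omega> * (fst (\<phi> (t + 1) \<omega>) - fst (\<phi> t \<omega>)) +
        ?cost (snd (\<phi> (t + 1) \<omega>) - snd (\<phi> t \<omega>)) (P_bid t \<omega>) (P_ask t \<omega>)
      = ?cost (snd (\<phi> t \<omega>)) (dA_bid t \<omega>) (dA_ask t \<omega>)"
    using sf unfolding self_financing_def by (intro AE_finite_allI) auto
  show ?thesis
    using P A X SF AE_B_pos r_0 V0
  proof eventually_elim
    case (elim \<omega>)
    define a where "a t = fst (\<phi> t \<omega>)" for t
    define x where "x t = snd (\<phi> t \<omega>)" for t
    have Bpos: "0 < B t \<omega>" if "t \<le> T" for t
      using elim that by auto
    have B0: "B 0 \<omega> = 1"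
      using elim by (simp add: B_def)
    have P_bds: "P_bid t \<omega> \<le> B t \<omega> *\<^sub>R P t \<omega>" "B t \<omega> *\<^sub>R P t \<omega> \<le> P_ask t \<omega>" if "t \<le> T" for t
      using bspec[OF elim(1), of t] that
      by (simp_all add: P_bid_disc_def P_ask_disc_def inverse_scaleR_le_iff[OF Bpos])
    have A_bds: "dA_ask t \<omega> \<le> B t \<omega> *\<^sub>R A t \<omega>" "B t \<omega> *\<^sub>R A t \<omega> \<le> dA_bid t \<omega>"
      if "t \<in> {1..T}" for t
      using bspec[OF elim(2), of t] that
      by (simp_all add: A_bid_disc_def A_ask_disc_def inverse_scaleR_le_iff[OF Bpos])
    \<comment> \<open>The initial value uses undiscounted quotes, which agree with discounted ones
      as \<open>B 0 \<omega> = 1\<close>.\<close>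
    have "a 1 + x 1 \<bullet> P 0 \<omega> \<le> 0"
      using elim(7) inner_le_sum_bid_ask[OF P_bds[of 0], of "x 1"] B0
      by (simp add: V_def a_def x_def)
    moreover have "a (t + 1) - a t + (x (t + 1) - x t) \<bullet> P t \<omega> \<le> x t \<bullet> A t \<omega>"
      if t: "t \<in> {1..T - 1}" for t
    proof -
      have t': "t \<in> {1..T}" "t \<le> T" using t by auto
      \<comment> \<open>At frictionless prices rebalancing costs no more and dividends pay no less,
        so the self-financing equation becomes an inequality.\<close>
      have "B t \<omega> * (a (t + 1) - a t) + (x (t + 1) - x t) \<bullet> (B t \<omega> *\<^sub>R P t \<omega>) \<le>
          x t \<bullet> (B t \<omega> *\<^sub>R A t \<omega>)"
        using bspec[OF elim(4) t] inner_le_sum_bid_ask[OF P_bds[OF t'(2)], of "x (t + 1) - x t"]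
          sum_bid_ask_le_inner[OF A_bds[OF t'(1)], of "x t"]
        unfolding a_def x_def by linarith
      then have "B t \<omega> * (a (t + 1) - a t + (x (t + 1) - x t) \<bullet> P t \<omega>) \<le> B t \<omega> * (x t \<bullet> A t \<omega>)"
        by (simp add: distrib_left)
      then show ?thesis
        using Bpos[OF t'(2)] by simp
    qed
    moreover have "X t \<omega> = P t \<omega> + (\<Sum>u=1..t. A u \<omega>)" if "t \<le> T" for t
      using elim(3) that by auto
    ultimately have "a T + x T \<bullet> P T \<omega> + x T \<bullet> A T \<omega> \<le> (\<Sum>t=1..T. x t \<bullet> (X t \<omega> - X (t - 1) \<omega>))"
      using T_ge_1
      by (intro frictionless_wealth_le_gains[where p = "\<lambda>t. P t \<omega>" and d = "\<lambda>t. A t \<omega>"]) auto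
    \<comment> \<open>\<open>T_ge_1\<close> selects the liquidation branch of
      \<open>V\<close>.\<close>
    moreover have "V \<phi> T \<omega> \<le> a T * B T \<omega> + x T \<bullet> (B T \<omega> *\<^sub>R P T \<omega>) + x T \<bullet> (B T \<omega> *\<^sub>R A T \<omega>)"
      using sum_bid_ask_le_inner[OF P_bds[of T], of "x T"]
        sum_bid_ask_le_inner[OF A_bds[of T], of "x T"] T_ge_1
      by (simp add: V_def a_def x_def)
    then have "V \<phi> T \<omega> / B T \<omega> \<le> a T + x T \<bullet> P T \<omega> + x T \<bullet> A T \<omega>"
      using Bpos[of T] by (simp add: field_simps)
    ultimately show ?case
      by (simp add: x_def)
  qed
qed

lemma consistent_pricing_system_imp_NA:
  assumes cps: "consistent_pricing_system Q P A X"
  shows NA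
  unfolding NA_def
proof (intro ballI impI)
  fix \<phi>
  assume "\<phi> \<in> self_financing_strategies"
    and V0: "AE \<omega> in M. V \<phi> 0 \<omega> = 0"
    and VT: "AE \<omega> in M. V \<phi> T \<omega> \<ge> 0"
  then have ts: "trading_strategy \<phi>" and sf: "self_financing \<phi>"
    by (auto simp: self_financing_strategies_def)
  define gains where "gains \<omega> = (\<Sum>t=1..T. snd (\<phi> t \<omega>) \<bullet> (X t \<omega> - X (t - 1) \<omega>))" for \<omega>
  have Q: "finite_measure Q" "sets Q = sets M"
    and MQ: "absolutely_continuous M Q" and QM: "absolutely_continuous Q M"
    and X: "martingale_upto T Q F X"
    using cps by (auto simp: consistent_pricing_system_def Z_def prob_space_def)
  have le: "AE \<omega> in M. V \<phi> T \<omega> / B T \<omega> \<le> gains \<omega>"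
    unfolding gains_def by (rule AE_discounted_value_le_gains[OF cps sf V0])
  have "AE \<omega> in M. 0 \<le> gains \<omega>"
    using le VT AE_B_pos
  proof eventually_elim
    case (elim \<omega>)
    then have "0 \<le> V \<phi> T \<omega> / B T \<omega>"
      by (intro divide_nonneg_pos) auto
    then show ?case using elim(1) by linarith
  qed
  \<comment> \<open>The martingale property holds under \<open>Q\<close>; equivalence of the
    measures carries null sets there and back.\<close>
  then have "AE \<omega> in Q. 0 \<le> gains \<omega>"
    using absolutely_continuous_AE[OF Q(2) MQ] by blast
  then have "AE \<omega> in Q. gains \<omega> = 0"
    unfolding gains_def
  proof (intro martingale_transform_nonneg_imp_zero[OF Q(1) _ filtration_mono X])
    show "subalgebra Q (F t)" if "t \<le> T" for t
      using filtration_mono[OF that order_refl] Q(2) sets_F_T sets_eq_imp_space_eq[OF Q(2)]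
        sets_eq_imp_space_eq[OF sets_F_T]
      by (simp add: subalgebra_def)
    show "(\<lambda>\<omega>. snd (\<phi> t \<omega>)) \<in> borel_measurable (F (t - 1))" if "t \<in> {1..T}" for t
      using ts that borel_measurable_continuous_on[of snd "\<phi> t" "F (t - 1)"]
      by (auto simp: trading_strategy_def continuous_on_snd)
  qed auto
  then have "AE \<omega> in M. gains \<omega> = 0"
    using absolutely_continuous_AE[OF Q(2)[symmetric] QM] by blast
  \<comment> \<open>Zero gains bound the terminal value above by zero, and \<open>VT\<close> bounds
    it below.\<close>
  then show "AE \<omega> in M. V \<phi> T \<omega> = 0"
    using le VT AE_B_pos
  proof eventually_elim
    case (elim \<omega>)
    then have "0 < B T \<omega>" "V \<phi> T \<omega> / B T \<omega> \<le> 0"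
      by auto
    then have "V \<phi> T \<omega> \<le> 0"
      by (simp add: divide_le_0_iff)
    then show ?case using elim by simp
  qed
qed

end

theorem proposition4p2:
  fixes M :: "'a measure"
    and T :: nat
    and F :: "nat \<Rightarrow> 'a measure"
    and r :: "nat \<Rightarrow> 'a \<Rightarrow> real"
    and P_ask P_bid A_ask A_bid :: "nat \<Rightarrow> 'a \<Rightarrow> real ^ 'n::finite"
  assumes "bid_ask_market M T F r P_ask P_bid A_ask A_bid"
    and "\<exists>Q P A X. bid_ask_market.consistent_pricing_system M T F r P_ask P_bid A_ask A_bid Q P A X"
  shows "bid_ask_market.NA M T F r P_ask P_bid A_ask A_bid"
  using assms bid_ask_market.consistent_pricing_system_imp_NA by blast

end
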